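(* The map $T$ is a contraction on $(\mathcal{Q}_3,\mathrm{d}_3)$ with contraction constant at most $2^{-1/2}$, i.e. for all $\nu,\mu\in\mathcal{Q}_3$, $$\mathrm{d}_3(T\nu,T\mu)\le 2^{-1/2}\,\mathrm{d}_3(\nu,\mu).$$ In particular, for every $\nu\in\mathcal{Q}_3$ and every integer $n\ge 0$, $$\mathrm{d}_3(T^n\nu,\gamma)\le 2^{-n/2}\,\mathrm{d}_3(\nu,\gamma).$$
   Context: $\mathcal{Q}_3$ is the set of Borel probability measures $\nu$ on $\mathbb{R}$ with finite third absolute moment, mean $0$ and variance $1$: $\int |x|^3\,d\nu(x)<\infty$, $\int x\,d\nu(x)=0$, $\int x^2\,d\nu(x)=1$. For a probability measure $\nu$ on $\mathbb{R}$, $\varphi_\nu(\xi)=\int e^{\mathrm{i}x\xi}\,d\nu(x)$ is its characteristic function. For $\nu,\mu\in\mathcal{Q}_3$, $$\mathrm{d}_3(\nu,\mu)=\sup_{\xi\in\mathbb{R}\setminus\{0\}}\frac{|\varphi_\nu(\xi)-\varphi_\mu(\xi)|}{|\xi|^3},$$ which is a finite distance on $\mathcal{Q}_3$. The renormalization map $T$ sends a probability measure $\nu$ on $\mathbb{R}$ to the law $T\nu$ of $(X+Y)/\sqrt{2}$, where $X,Y$ are independent random variables of law $\nu$; $T$ maps $\mathcal{Q}_3$ into itself. $T^n$ is the $n$-fold iterate of $T$. $\gamma$ is the standard normal law $\mathcal{N}(0,1)$, $d\gamma(x)=\frac{1}{\sqrt{2\pi}}e^{-x^2/2}\,dx$,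 which belongs to $\mathcal{Q}_3$. *)

theory Defs
  imports "HOL-Probability.Probability"
begin

definition Q3 :: "real measure set" where
  "Q3 = {\<nu>. real_distribution \<nu> \<and> integrable \<nu> (\<lambda>x. \<bar>x\<bar> ^ 3) \<and>
             (\<integral>x. x \<partial>\<nu>) = 0 \<and> (\<integral>x. x\<^sup>2 \<partial>\<nu>) = 1}"

text \<open>The supremum is taken in the reals, so it is only meaningful when the quotients are bounded;
  \<open>bdd_above_d3\<close> below shows that they are for measures in \<open>Q3\<close>.\<close>

definition d3 :: "real measure \<Rightarrow> real measure \<Rightarrow> real" where
  "d3 \<nu> \<mu> = (SUP \<xi>\<in>UNIV - {0}. norm (char \<nu> \<xi> - char \<mu> \<xi>) / \<bar>\<xi>\<bar> ^ 3)"

text \<open>The coordinates of the product measure \<open>\<nu> \<Otimes>\<^sub>M \<nu>\<close> are independent with law \<open>\<nu>\<close>.\<close>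

definition renorm :: "real measure \<Rightarrow> real measure" where
  "renorm \<nu> = distr (\<nu> \<Otimes>\<^sub>M \<nu>) borel (\<lambda>(x, y). (x + y) / sqrt 2)"

lemma char_Q3_approx:
  assumes "\<nu> \<in> Q3"
  shows "norm (char \<nu> t - (1 - t\<^sup>2 / 2)) \<le> \<bar>t\<bar> ^ 3 / 6 * (\<integral>x. \<bar>x\<bar> ^ 3 \<partial>\<nu>)"
proof -
  interpret real_distribution \<nu> using assms by (simp add: Q3_def)
  have i3: "integrable \<nu> (\<lambda>x. \<bar>x\<bar> ^ 3)" and m1: "(\<integral>x. x \<partial>\<nu>) = 0" and m2: "(\<integral>x. x\<^sup>2 \<partial>\<nu>) = 1"
    using assms by (simp_all add: Q3_def)
  have i2: "integrable \<nu> (\<lambda>x. x\<^sup>2)"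
    using m2 not_integrable_integral_eq by force
  have i1: "integrable \<nu> (\<lambda>x. x)"
    by (rule square_integrable_imp_integrable) (use i2 in auto)
  have var: "variance (\<lambda>x. x) = 1"
    using m1 m2 by simp
  have "norm (char \<nu> t - (1 - t\<^sup>2 * 1 / 2)) \<le> (t\<^sup>2 / 6) * expectation (\<lambda>x. min (6 * x\<^sup>2) (\<bar>t\<bar> * \<bar>x\<bar> ^ 3))"
    using char_approx3[OF i1 m1 i2 var, of t] by simp
  also have "\<dots> \<le> (t\<^sup>2 / 6) * expectation (\<lambda>x. \<bar>t\<bar> * \<bar>x\<bar> ^ 3)"
    using i2 i3 by (intro mult_left_mono integral_mono integrable_min) auto
  also have "\<dots> = \<bar>t\<bar> ^ 3 / 6 * expectation (\<lambda>x. \<bar>x\<bar> ^ 3)"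
  proof -
    have "t\<^sup>2 * \<bar>t\<bar> = \<bar>t\<bar> ^ 3"
      by (metis power2_abs power2_eq_square power3_eq_cube)
    then show ?thesis by simp
  qed
  finally show ?thesis by simp
qed

lemma bdd_above_d3:
  assumes "\<nu> \<in> Q3" "\<mu> \<in> Q3"
  shows "bdd_above ((\<lambda>\<xi>. norm (char \<nu> \<xi> - char \<mu> \<xi>) / \<bar>\<xi>\<bar> ^ 3) ` (UNIV - {0}))"
proof (rule bdd_aboveI2)
  fix \<xi> :: real assume "\<xi> \<in> UNIV - {0}"
  then have "\<bar>\<xi>\<bar> ^ 3 > 0" by simp
  let ?a = "\<integral>x. \<bar>x\<bar> ^ 3 \<partial>\<nu>" and ?b = "\<integral>x. \<bar>x\<bar> ^ 3 \<partial>\<mu>"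
  have "norm (char \<nu> \<xi> - char \<mu> \<xi>) \<le>
      norm (char \<nu> \<xi> - (1 - \<xi>\<^sup>2 / 2)) + norm (char \<mu> \<xi> - (1 - \<xi>\<^sup>2 / 2))"
    by (rule norm_diff_triangle_le[OF order_refl]) (simp add: norm_minus_commute)
  also have "\<dots> \<le> (?a + ?b) / 6 * \<bar>\<xi>\<bar> ^ 3"
    using char_Q3_approx[OF assms(1), of \<xi>] char_Q3_approx[OF assms(2), of \<xi>]
    by (simp add: algebra_simps add_divide_distrib)
  finally show "norm (char \<nu> \<xi> - char \<mu> \<xi>) / \<bar>\<xi>\<bar> ^ 3 \<le> (?a + ?b) / 6"
    using \<open>\<bar>\<xi>\<bar> ^ 3 > 0\<close> by (simp add: pos_divide_le_eq)
qed

lemma std_normal_in_Q3: "std_normal_distribution \<in> Q3"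
proof -
  have "integrable std_normal_distribution (\<lambda>x. \<bar>x\<bar> ^ 3)"
    using integrable_abs[OF integrable_std_normal_distribution_moment[of 3]] by (simp add: power_abs)
  moreover have "(\<integral>x. x \<partial>std_normal_distribution) = 0"
    using integral_std_normal_distribution_moment_odd[of 1] by simp
  moreover have "(\<integral>x. x\<^sup>2 \<partial>std_normal_distribution) = 1"
    using std_normal_distribution_even_moments(1)[of 1] by simp
  ultimately show ?thesis
    by (simp add: Q3_def real_dist_normal_dist)
qed

end

(* Since T\<nu> has characteristic function \<phi>(\<xi> / sqrt 2)^2, where \<phi> is that of \<nu>, and characteristic
   functions have modulus at most 1, the factorization a^2 - b^2 = (a + b)(a - b) gives
   |a^2 - b^2| \<le> 2 |a - b| at \<xi> / sqrt 2. Dividing by |\<xi>|^3 = 2^(3/2) |\<xi> / sqrt 2|^3 leaves the factor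
   2 / 2^(3/2) = 2^(-1/2). The Gaussian is a fixed point of T, so iterating gives the convergence rate. *)
theory Submission
  imports Defs
begin

text \<open>Fubini for a product of one-variable functions. The value type is a general normed field
  so that the same rule serves complex exponentials, for characteristic functions, and real
  monomials, for moments.\<close>

lemma (in pair_sigma_finite)
  fixes f :: "'a \<Rightarrow> 'c::{real_normed_field, banach, second_countable_topology}"
  assumes f: "integrable M1 f" and g: "integrable M2 g"
  shows integrable_pair_mult: "integrable (M1 \<Otimes>\<^sub>M M2) (\<lambda>(x, y). f x * g y)"
    and integral_pair_mult: "(\<integral>(x, y). f x * g y \<partial>(M1 \<Otimes>\<^sub>M M2)) = (\<integral>x. f x \<partial>M1) * (\<integral>y. g y \<partial>M2)"
proof -
  note [measurable] = borel_measurable_integrable[OF f] borel_measurable_integrable[OF g]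
  show i: "integrable (M1 \<Otimes>\<^sub>M M2) (\<lambda>(x, y). f x * g y)"
    by (rule Fubini_integrable) (use f g in \<open>auto simp: norm_mult\<close>)
  show "(\<integral>(x, y). f x * g y \<partial>(M1 \<Otimes>\<^sub>M M2)) = (\<integral>x. f x \<partial>M1) * (\<integral>y. g y \<partial>M2)"
    using integral_fst'[OF i] by simp
qed

lemma abs_add_power3_le: "\<bar>x + y\<bar> ^ 3 \<le> 4 * (\<bar>x\<bar> ^ 3 + \<bar>y\<bar> ^ 3)" for x y :: real
proof -
  let ?a = "\<bar>x\<bar>" and ?b = "\<bar>y\<bar>"
  have "\<bar>x + y\<bar> ^ 3 \<le> (?a + ?b) ^ 3"
    by (intro power_mono abs_triangle_ineq) auto
  \<comment> \<open>Convexity of the cube made explicit: the defect is a nonnegative multiple of a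
    square.\<close>
  also have "\<dots> = 4 * (?a ^ 3 + ?b ^ 3) - 3 * (?a + ?b) * (?a - ?b)\<^sup>2"
    by algebra
  also have "\<dots> \<le> 4 * (?a ^ 3 + ?b ^ 3)"
    by simp
  finally show ?thesis .
qed

context
  fixes \<nu> :: "real measure"
  assumes real_distribution: "real_distribution \<nu>"
begin

interpretation real_distribution \<nu>
  by (rule real_distribution)

interpretation PP: pair_prob_space \<nu> \<nu> ..

lemma real_distribution_renorm: "real_distribution (renorm \<nu>)"
  unfolding renorm_def by (rule PP.P.real_distribution_distr) measurable

text \<open>The exponential turns the scaled sum into a product, one factor per coordinate, and
  independence splits its integral.\<close>

lemma char_renorm: "char (renorm \<nu>) t = (char \<nu> (t / sqrt 2))\<^sup>2"
proof -
  have i: "integrable \<nu> (\<lambda>x. iexp (t / sqrt 2 * x))"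
    by (rule integrable_iexp) auto
  have "char (renorm \<nu>) t = (\<integral>(x, y). iexp (t / sqrt 2 * x) * iexp (t / sqrt 2 * y) \<partial>(\<nu> \<Otimes>\<^sub>M \<nu>))"
    unfolding char_def renorm_def
    by (subst integral_distr)
      (auto intro!: Bochner_Integration.integral_cong simp: exp_add[symmetric] field_simps)
  also have "\<dots> = (char \<nu> (t / sqrt 2))\<^sup>2"
    by (subst PP.integral_pair_mult[OF i i]) (simp add: char_def power2_eq_square)
  finally show ?thesis .
qed

end

lemma renorm_in_Q3:
  assumes "\<nu> \<in> Q3"
  shows "renorm \<nu> \<in> Q3"
proof -
  interpret real_distribution \<nu> using assms by (simp add: Q3_def)
  interpret PP: pair_prob_space \<nu> \<nu> ..
  let ?P = "\<nu> \<Otimes>\<^sub>M \<nu>"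
  have i3: "integrable \<nu> (\<lambda>x. \<bar>x\<bar> ^ 3)" and m1: "(\<integral>x. x \<partial>\<nu>) = 0" and m2: "(\<integral>x. x\<^sup>2 \<partial>\<nu>) = 1"
    using assms by (simp_all add: Q3_def)
  \<comment> \<open>A non-integrable function has Bochner integral 0 by default, so the value 1
    forces integrability.\<close>
  have i2: "integrable \<nu> (\<lambda>x. x\<^sup>2)"
    using m2 not_integrable_integral_eq by force
  have i1: "integrable \<nu> (\<lambda>x. x)"
    by (rule square_integrable_imp_integrable) (use i2 in auto)
  \<comment> \<open>Taking 1 as the other factor lets functions of a single coordinate fit the
    product rules.\<close>
  have i0: "integrable \<nu> (\<lambda>x. 1 :: real)"
    by simp
  note int = PP.integrable_pair_mult[unfolded case_prod_beta]
  note eq = PP.integral_pair_mult[unfolded case_prod_beta]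

  have 3: "integrable (renorm \<nu>) (\<lambda>x. \<bar>x\<bar> ^ 3)"
  proof -
    \<comment> \<open>This integrable function dominates the cube of the scaled sum by
      \<open>abs_add_power3_le\<close>.\<close>
    have "integrable ?P (\<lambda>p. 4 * (\<bar>fst p\<bar> ^ 3 + \<bar>snd p\<bar> ^ 3) / sqrt 2 ^ 3)"
      using int[OF i3 i0] int[OF i0 i3] by simp
    then have "integrable ?P (\<lambda>p. \<bar>(fst p + snd p) / sqrt 2\<bar> ^ 3)"
      by (rule Bochner_Integration.integrable_bound)
        (use abs_add_power3_le in \<open>auto simp: power_divide intro!: divide_right_mono\<close>)
    then show ?thesis
      unfolding renorm_def by (subst integrable_distr_eq) (auto simp: case_prod_beta)
  qed
  have 1: "(\<integral>x. x \<partial>renorm \<nu>) = 0"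
  proof -
    have "(\<integral>x. x \<partial>renorm \<nu>) = (\<integral>p. (fst p * 1 + 1 * snd p) / sqrt 2 \<partial>?P)"
      unfolding renorm_def case_prod_beta by (subst integral_distr) auto
    also have "\<dots> = ((\<integral>p. fst p * 1 \<partial>?P) + (\<integral>p. 1 * snd p \<partial>?P)) / sqrt 2"
      using int[OF i1 i0] int[OF i0 i1] by simp
    also have "\<dots> = 0"
      by (simp only: eq[OF i1 i0] eq[OF i0 i1] m1) simp
    finally show ?thesis .
  qed
  have 2: "(\<integral>x. x\<^sup>2 \<partial>renorm \<nu>) = 1"
  proof -
    \<comment> \<open>By independence the cross term integrates to the squared mean, which is 0; the
      two pure squares contribute (1 + 1) / 2.\<close>
    have "(\<integral>x. x\<^sup>2 \<partial>renorm \<nu>) =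
        (\<integral>p. ((fst p)\<^sup>2 * 1 + 1 * (snd p)\<^sup>2 + 2 * (fst p * snd p)) / 2 \<partial>?P)"
      unfolding renorm_def
      by (subst integral_distr)
        (auto simp: case_prod_beta power2_sum power_divide intro!: Bochner_Integration.integral_cong)
    also have "\<dots> = ((\<integral>p. (fst p)\<^sup>2 * 1 \<partial>?P) + (\<integral>p. 1 * (snd p)\<^sup>2 \<partial>?P)
        + 2 * (\<integral>p. fst p * snd p \<partial>?P)) / 2"
      using int[OF i2 i0] int[OF i0 i2] int[OF i1 i1] by simp
    also have "\<dots> = 1"
      by (simp only: eq[OF i2 i0] eq[OF i0 i2] eq[OF i1 i1] m1 m2) (use prob_space in simp)
    finally show ?thesis .
  qed
  show ?thesis
    using 1 2 3 real_distribution_renorm[OF real_distribution_axioms] by (simp add: Q3_def)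
qed

lemma d3_renorm_le:
  assumes \<nu>: "\<nu> \<in> Q3" and \<mu>: "\<mu> \<in> Q3"
  shows "d3 (renorm \<nu>) (renorm \<mu>) \<le> 2 powr (- 1 / 2) * d3 \<nu> \<mu>"
  \<comment> \<open>Only the left distance is opened; the right one stays a fixed bound to be met at
    every \<xi>.\<close>
  unfolding d3_def[of "renorm \<nu>"]
proof (rule cSUP_least)
  show "UNIV - {0 :: real} \<noteq> {}"
    by (metis DiffI UNIV_I empty_iff singletonD zero_neq_one)
next
  interpret N: real_distribution \<nu> using \<nu> by (simp add: Q3_def)
  interpret M: real_distribution \<mu> using \<mu> by (simp add: Q3_def)
  fix \<xi> :: real assume "\<xi> \<in> UNIV - {0}"
  define \<eta> where "\<eta> = \<xi> / sqrt 2"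
  have \<eta>: "\<eta> \<noteq> 0" and \<xi>: "\<xi> = sqrt 2 * \<eta>"
    using \<open>\<xi> \<in> UNIV - {0}\<close> by (auto simp: \<eta>_def)
  let ?a = "char \<nu> \<eta>" and ?b = "char \<mu> \<eta>"
  have "norm (char (renorm \<nu>) \<xi> - char (renorm \<mu>) \<xi>) = norm (?a + ?b) * norm (?a - ?b)"
    by (simp add: char_renorm N.real_distribution_axioms M.real_distribution_axioms
        \<eta>_def[symmetric] power2_eq_square square_diff_square_factored norm_mult)
  also have "\<dots> \<le> 2 * norm (?a - ?b)"
    using norm_triangle_mono[OF N.cmod_char_le_1 M.cmod_char_le_1, of \<eta> \<eta>]
    by (intro mult_right_mono) auto
  finally have "norm (char (renorm \<nu>) \<xi> - char (renorm \<mu>) \<xi>) / \<bar>\<xi>\<bar> ^ 3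
      \<le> 2 * norm (?a - ?b) / \<bar>\<xi>\<bar> ^ 3"
    by (rule divide_right_mono) simp
  also have "\<dots> = 2 powr (- 1 / 2) * (norm (?a - ?b) / \<bar>\<eta>\<bar> ^ 3)"
  proof -
    have "sqrt 2 ^ 3 = 2 * sqrt (2 :: real)"
      by (simp add: power3_eq_cube)
    then show ?thesis
      by (simp add: \<xi> abs_mult power_mult_distrib powr_minus_divide powr_half_sqrt)
  qed
  \<comment> \<open>The real supremum dominates its value at \<eta> because the quotients are
    bounded, by \<open>bdd_above_d3\<close>.\<close>
  also have "\<dots> \<le> 2 powr (- 1 / 2) * d3 \<nu> \<mu>"
    unfolding d3_def using \<eta> by (intro mult_left_mono cSUP_upper bdd_above_d3 \<nu> \<mu>) auto
  finally show "norm (char (renorm \<nu>) \<xi> - char (renorm \<mu>) \<xi>) / \<bar>\<xi>\<bar> ^ 3 \<le> 2 powr (- 1 / 2) * d3 \<nu> \<mu>" .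
qed

text \<open>Squaring exp (- t^2 / 4) gives back exp (- t^2 / 2), and a characteristic function
  determines its law.\<close>

lemma renorm_std_normal: "renorm std_normal_distribution = std_normal_distribution"
proof (rule Levy_uniqueness)
  show "char (renorm std_normal_distribution) = char std_normal_distribution"
  proof
    fix t :: real
    have "(exp (- (t / sqrt 2)\<^sup>2 / 2))\<^sup>2 = exp (- t\<^sup>2 / 2)"
      by (simp add: power2_eq_square exp_add[symmetric])
    then show "char (renorm std_normal_distribution) t = char std_normal_distribution t"
      by (simp only: char_renorm[OF real_dist_normal_dist] char_std_normal_distribution
          of_real_power[symmetric])
  qed
qed (intro real_distribution_renorm real_dist_normal_dist)+

theorem theorem1p3:
  shows "renorm \<in> Q3 \<rightarrow> Q3 \<and>
    (\<forall>\<nu>\<in>Q3. \<forall>\<mu>\<in>Q3. d3 (renorm \<nu>) (renorm \<mu>) \<le> 2 powr (- 1 / 2) * d3 \<nu> \<mu>) \<and>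
    (\<forall>\<nu>\<in>Q3. \<forall>n::nat. d3 ((renorm ^^ n) \<nu>) std_normal_distribution
        \<le> 2 powr (- real n / 2) * d3 \<nu> std_normal_distribution)"
proof (intro conjI ballI allI)
  show "renorm \<in> Q3 \<rightarrow> Q3"
    using renorm_in_Q3 by blast
next
  fix \<nu> \<mu> assume "\<nu> \<in> Q3" "\<mu> \<in> Q3"
  then show "d3 (renorm \<nu>) (renorm \<mu>) \<le> 2 powr (- 1 / 2) * d3 \<nu> \<mu>"
    by (rule d3_renorm_le)
next
  fix \<nu> and n :: nat assume \<nu>: "\<nu> \<in> Q3"
  have iter: "(renorm ^^ k) \<nu> \<in> Q3" for k
    by (induction k) (use \<nu> renorm_in_Q3 in auto)
  show "d3 ((renorm ^^ n) \<nu>) std_normal_distribution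
      \<le> 2 powr (- real n / 2) * d3 \<nu> std_normal_distribution"
  proof (induction n)
    case 0
    show ?case by simp
  next
    case (Suc n)
    \<comment> \<open>Writing the Gaussian as its own image puts both arguments under
      \<open>renorm\<close>, so that one contraction step applies.\<close>
    have "d3 ((renorm ^^ Suc n) \<nu>) std_normal_distribution
        = d3 (renorm ((renorm ^^ n) \<nu>)) (renorm std_normal_distribution)"
      by (simp add: renorm_std_normal)
    also have "\<dots> \<le> 2 powr (- 1 / 2) * d3 ((renorm ^^ n) \<nu>) std_normal_distribution"
      by (rule d3_renorm_le[OF iter std_normal_in_Q3])
    also have "\<dots> \<le> 2 powr (- 1 / 2) * (2 powr (- real n / 2) * d3 \<nu> std_normal_distribution)"
      by (intro mult_left_mono Suc.IH) simp
    also have "\<dots> = 2 powr (- real (Suc n) / 2) * d3 \<nu> std_normal_distribution"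
      by (simp add: mult.assoc[symmetric] powr_add[symmetric] diff_divide_distrib)
    finally show ?case .
  qed
qed

end
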